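(* Let $n\ge1$, $B\in\mathcal{M}_{n\times n}(\mathbb{R})$, let $(X,d)$ be a complete vector $B$-metric space with $X$ nonempty, and let $N\colon X\to X$ be an operator such that $$d(N(x),N(y))\le A\,d(x,y)\quad\text{for all }x,y\in X$$ with a matrix $A\in\mathcal{M}_{n\times n}(\mathbb{R}_+)$ convergent to zero. In addition assume that either (a) $B$ and $B^{-1}-A$ are inverse-positive; or (b) $B$ is positive and $I-BA$ is inverse-positive. Then $N$ is stable in the sense of Reich and Zaslavski, i.e., $N$ has a unique fixed point $x^\ast$, and for every sequence $(x_k)\subset X$ satisfying $d(x_k,N(x_k))\to0$ as $k\to\infty$, one has $x_k\to x^\ast$ as $k\to\infty$.
   Context: Vectors in $\mathbb{R}^n$ are columns; inequalities between vectors (and between matrices of the same size) and convergence of sequences of vectors or matrices are understood componentwise; $\mathbb{R}_+=[0,\infty)$; $I$ is the $n\times n$ identity matrix. For a set $X$ and an arbitrary matrix $B\in\mathcal{M}_{n\times n}(\mathbb{R})$, a vector $B$-metric on $X$ is a mapping $d\colon X\times X\to\mathbb{R}^n_+$ such that for all $u,v,w\in X$: $d(u,v)=0$ if and only if $u=v$; $d(u,v)=d(v,u)$; and $d(u,w)\le B\,(d(u,v)+d(v,w))$. Then $(X,d)$ is called a vector $B$-metric space. A sequence $(x_k)$ converges to $x$ (written $x_k\to x$) if $d(x_k,x)\to 0$; it is Cauchy if $d(x_k,x_p)\to0$ as $k,p\to\infty$; $(X,d)$ is complete if every Cauchy sequence converges to a point of $X$. A matrix is positive if all its entries are nonnegative;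 a square real matrix is inverse-positive if it is invertible and its inverse is positive; a positive matrix $M$ is convergent to zero if $M^k\to 0$ as $k\to\infty$. *)

theory Defs
  imports "HOL-Analysis.Analysis"
begin

text \<open>
  The order on \<^typ>\<open>real ^ 'n\<close> and on \<^typ>\<open>real ^ 'n ^ 'n\<close> is the componentwise one,
  and the topology is that of componentwise convergence.
  The library operations \<open>*\<close>, \<open>^\<close> and \<open>1\<close> on these types are also componentwise, hence the
  separate definition of matrix powers below.
\<close>

primrec matpow :: "real ^ 'n ^ 'n \<Rightarrow> nat \<Rightarrow> real ^ 'n ^ 'n" where
  "matpow M 0 = mat 1"
| "matpow M (Suc k) = M ** matpow M k"

definition positive_mat :: "real ^ 'n ^ 'm \<Rightarrow> bool" where
  "positive_mat M \<longleftrightarrow> 0 \<le> M"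

definition inverse_positive :: "real ^ 'n ^ 'n \<Rightarrow> bool" where
  "inverse_positive M \<longleftrightarrow> invertible M \<and> positive_mat (matrix_inv M)"

definition mat_convergent_to_zero :: "real ^ 'n ^ 'n \<Rightarrow> bool" where
  "mat_convergent_to_zero M \<longleftrightarrow> positive_mat M \<and> (\<lambda>k. matpow M k) \<longlonglongrightarrow> 0"

definition vector_B_metric :: "real ^ 'n ^ 'n \<Rightarrow> 'a set \<Rightarrow> ('a \<Rightarrow> 'a \<Rightarrow> real ^ 'n) \<Rightarrow> bool" where
  "vector_B_metric B X d \<longleftrightarrow>
     (\<forall>u\<in>X. \<forall>v\<in>X. 0 \<le> d u v) \<and>
     (\<forall>u\<in>X. \<forall>v\<in>X. d u v = 0 \<longleftrightarrow> u = v) \<and>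
     (\<forall>u\<in>X. \<forall>v\<in>X. d u v = d v u) \<and>
     (\<forall>u\<in>X. \<forall>v\<in>X. \<forall>w\<in>X. d u w \<le> B *v (d u v + d v w))"

definition vconverges :: "('a \<Rightarrow> 'a \<Rightarrow> real ^ 'n) \<Rightarrow> (nat \<Rightarrow> 'a) \<Rightarrow> 'a \<Rightarrow> bool" where
  "vconverges d x l \<longleftrightarrow> (\<lambda>k. d (x k) l) \<longlonglongrightarrow> 0"

definition vCauchy :: "('a \<Rightarrow> 'a \<Rightarrow> real ^ 'n) \<Rightarrow> (nat \<Rightarrow> 'a) \<Rightarrow> bool" where
  "vCauchy d x \<longleftrightarrow> ((\<lambda>(k, p). d (x k) (x p)) \<longlongrightarrow> 0) (sequentially \<times>\<^sub>F sequentially)"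

definition vcomplete :: "'a set \<Rightarrow> ('a \<Rightarrow> 'a \<Rightarrow> real ^ 'n) \<Rightarrow> bool" where
  "vcomplete X d \<longleftrightarrow>
     (\<forall>x. range x \<subseteq> X \<longrightarrow> vCauchy d x \<longrightarrow> (\<exists>l\<in>X. vconverges d x l))"

definition Reich_Zaslavski_stable ::
    "'a set \<Rightarrow> ('a \<Rightarrow> 'a \<Rightarrow> real ^ 'n) \<Rightarrow> ('a \<Rightarrow> 'a) \<Rightarrow> bool" where
  "Reich_Zaslavski_stable X d N \<longleftrightarrow>
     (\<exists>xs\<in>X. N xs = xs \<and> (\<forall>y\<in>X. N y = y \<longrightarrow> y = xs) \<and>
        (\<forall>x. range x \<subseteq> X \<longrightarrow> (\<lambda>k. d (x k) (N (x k))) \<longlonglongrightarrow> 0 \<longrightarrow> vconverges d x xs))"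

end

theory Submission
  imports Defs
begin

text \<open>
  Passing to \<open>\<rho> u v = norm (d u v)\<close> turns the vector-valued problem into a scalar one. Since
  \<open>0 \<le> a \<le> b\<close> implies \<open>norm a \<le> norm b\<close>, the \<open>B\<close>-triangle inequality becomes
  \<open>\<rho> u w \<le> C * (\<rho> u v + \<rho> v w)\<close> with \<open>C\<close> the operator norm of \<open>B\<close>, and the \<open>m\<close>-th iterate of
  \<open>N\<close> becomes Lipschitz with a constant \<open>c m\<close> governed by \<open>A\<^sup>m\<close>, so that \<open>c m \<longlonglongrightarrow> 0\<close>.

  The constant \<open>C\<close> may be large, so \<open>N\<close> itself may contract too weakly to absorb it; but
  \<open>C\<^sup>2 * c m \<le> 1 / 2\<close> for a suitable \<open>m\<close>. Going from \<open>u\<close> to \<open>v\<close> via \<open>N\<^sup>m u\<close> and \<open>N\<^sup>m v\<close> then gives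
  \<open>\<rho> u v \<le> C * \<rho> u (N\<^sup>m u) + C\<^sup>2 * \<rho> (N\<^sup>m v) v + \<rho> u v / 2\<close>, and the last term can be absorbed. As
  the displacement of \<open>N\<^sup>m\<close> is controlled by that of \<open>N\<close>, there is a \<open>K\<close> with
  \<open>\<rho> u v \<le> K * (\<rho> u (N u) + \<rho> v (N v))\<close> for all points \<open>u\<close> and \<open>v\<close>
  (\<open>distance_le_displacements\<close> below). This one inequality yields everything: fixed points have
  displacement zero, so they coincide; a sequence whose displacements tend to zero is Cauchy,
  in particular the Picard iteration; and such a sequence converges to the fixed point.
\<close>

section \<open>Scalar b-metrics and maps with vanishing iterated Lipschitz constants\<close>

text \<open>
  Each iterate carries its own constant, unrelated to the powers of \<open>c 1\<close>: the norm of \<open>A\<close> may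
  exceed 1 although \<open>A\<^sup>m\<close> tends to zero.
\<close>

locale b_metric_iterated_contraction =
  fixes X :: "'a set" and \<rho> :: "'a \<Rightarrow> 'a \<Rightarrow> real" and C :: real
    and N :: "'a \<Rightarrow> 'a" and c :: "nat \<Rightarrow> real"
  assumes nonneg: "\<lbrakk>u \<in> X; v \<in> X\<rbrakk> \<Longrightarrow> 0 \<le> \<rho> u v"
    and zero_iff: "\<lbrakk>u \<in> X; v \<in> X\<rbrakk> \<Longrightarrow> \<rho> u v = 0 \<longleftrightarrow> u = v"
    and sym: "\<lbrakk>u \<in> X; v \<in> X\<rbrakk> \<Longrightarrow> \<rho> u v = \<rho> v u"
    and C_nonneg: "0 \<le> C"
    and triangle: "\<lbrakk>u \<in> X; v \<in> X; w \<in> X\<rbrakk> \<Longrightarrow> \<rho> u w \<le> C * (\<rho> u v + \<rho> v w)"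
    and maps: "u \<in> X \<Longrightarrow> N u \<in> X"
    and c_nonneg: "0 \<le> c m"
    and lipschitz: "\<lbrakk>u \<in> X; v \<in> X\<rbrakk> \<Longrightarrow> \<rho> ((N ^^ m) u) ((N ^^ m) v) \<le> c m * \<rho> u v"
    and c_tendsto_0: "c \<longlonglongrightarrow> 0"
begin

lemma iterate_in: "u \<in> X \<Longrightarrow> (N ^^ m) u \<in> X"
  by (induction m) (auto intro: maps)

lemma self_distance: "u \<in> X \<Longrightarrow> \<rho> u u = 0"
  using zero_iff[of u u] by simp

lemma iterate_displacement_le:
  "\<exists>K\<ge>0. \<forall>u\<in>X. \<rho> u ((N ^^ m) u) \<le> K * \<rho> u (N u)"
proof (induction m)
  case 0
  show ?case by (rule exI[of _ 0]) (auto simp: self_distance)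
next
  case (Suc m)
  then obtain K where K: "K \<ge> 0" "\<And>u. u \<in> X \<Longrightarrow> \<rho> u ((N ^^ m) u) \<le> K * \<rho> u (N u)"
    by blast
  have "\<rho> u ((N ^^ Suc m) u) \<le> C * (K + c m) * \<rho> u (N u)" if u: "u \<in> X" for u
  proof -
    have "\<rho> u ((N ^^ Suc m) u) \<le> C * (\<rho> u ((N ^^ m) u) + \<rho> ((N ^^ m) u) ((N ^^ m) (N u)))"
      using triangle[OF u iterate_in[OF u] iterate_in[OF maps[OF u]], of m m]
      by (simp add: funpow_swap1)
    also have "\<dots> \<le> C * (K * \<rho> u (N u) + c m * \<rho> u (N u))"
      by (intro mult_left_mono add_mono K lipschitz u maps C_nonneg)
    finally show ?thesis by (simp add: algebra_simps)
  qed
  moreover have "0 \<le> C * (K + c m)" using K C_nonneg c_nonneg by simp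
  ultimately show ?case by blast
qed

text \<open>
  Two points that \<open>N\<close> hardly moves are close to each other: an iterate whose Lipschitz constant
  beats \<open>C\<^sup>2\<close> brings \<open>u\<close> and \<open>v\<close> together, yet moves neither of them far.
\<close>

lemma distance_le_displacements:
  "\<exists>K. \<forall>u\<in>X. \<forall>v\<in>X. \<rho> u v \<le> K * (\<rho> u (N u) + \<rho> v (N v))"
proof -
  have "(\<lambda>m. C\<^sup>2 * c m) \<longlonglongrightarrow> C\<^sup>2 * 0"
    by (intro tendsto_intros c_tendsto_0)
  then have "eventually (\<lambda>m. C\<^sup>2 * c m < 1 / 2) sequentially"
    by (rule order_tendstoD) simp
  then obtain m where "C\<^sup>2 * c m < 1 / 2"
    using eventually_happens'[OF sequentially_bot] by blast
  then have m: "C\<^sup>2 * c m \<le> 1 / 2" by simp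
  obtain K where K: "K \<ge> 0" "\<And>u. u \<in> X \<Longrightarrow> \<rho> u ((N ^^ m) u) \<le> K * \<rho> u (N u)"
    using iterate_displacement_le by blast
  let ?L = "2 * (C + C\<^sup>2) * K"
  have "\<rho> u v \<le> ?L * (\<rho> u (N u) + \<rho> v (N v))" if u: "u \<in> X" and v: "v \<in> X" for u v
  proof -
    let ?a = "\<rho> u (N u)" and ?b = "\<rho> v (N v)"
    have ab: "0 \<le> ?a" "0 \<le> ?b" using u v by (auto intro: nonneg maps)
    have "\<rho> ((N ^^ m) u) v \<le> C * (\<rho> ((N ^^ m) u) ((N ^^ m) v) + \<rho> v ((N ^^ m) v))"
      using triangle[OF iterate_in[OF u, of m] iterate_in[OF v, of m] v]
      unfolding sym[OF iterate_in[OF v, of m] v] .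
    also have "\<dots> \<le> C * (c m * \<rho> u v + K * ?b)"
      by (intro mult_left_mono add_mono K lipschitz u v C_nonneg)
    finally have *: "\<rho> ((N ^^ m) u) v \<le> C * (c m * \<rho> u v + K * ?b)" .
    have "\<rho> u v \<le> C * (\<rho> u ((N ^^ m) u) + \<rho> ((N ^^ m) u) v)"
      by (intro triangle iterate_in u v)
    also have "\<dots> \<le> C * (K * ?a + C * (c m * \<rho> u v + K * ?b))"
      by (intro mult_left_mono add_mono K u * C_nonneg)
    also have "\<dots> = C * K * ?a + C\<^sup>2 * K * ?b + C\<^sup>2 * c m * \<rho> u v"
      by (simp add: algebra_simps power2_eq_square)
    also have "\<dots> \<le> C * K * ?a + C\<^sup>2 * K * ?b + 1 / 2 * \<rho> u v"
      by (intro add_left_mono mult_right_mono m nonneg u v)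
    finally have "\<rho> u v \<le> 2 * (C * K * ?a + C\<^sup>2 * K * ?b)" by simp
    also have "\<dots> \<le> ?L * (?a + ?b)"
      using ab K(1) C_nonneg by (simp add: algebra_simps)
    finally show ?thesis .
  qed
  then show ?thesis by blast
qed

lemma fixed_point_unique:
  assumes "u \<in> X" "v \<in> X" "N u = u" "N v = v"
  shows "u = v"
proof -
  obtain K where K: "\<And>u v. \<lbrakk>u \<in> X; v \<in> X\<rbrakk> \<Longrightarrow> \<rho> u v \<le> K * (\<rho> u (N u) + \<rho> v (N v))"
    using distance_le_displacements by blast
  have "\<rho> u v \<le> 0" using K[OF assms(1,2)] assms by (simp add: self_distance)
  then show ?thesis using nonneg[OF assms(1,2)] zero_iff[OF assms(1,2)] by simp
qed

lemma Cauchy_of_vanishing_displacement: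
  assumes x: "range x \<subseteq> X" and disp: "(\<lambda>k. \<rho> (x k) (N (x k))) \<longlonglongrightarrow> 0"
  shows "((\<lambda>(k, p). \<rho> (x k) (x p)) \<longlongrightarrow> 0) (sequentially \<times>\<^sub>F sequentially)"
proof -
  have X: "x k \<in> X" for k using x by auto
  let ?e = "\<lambda>k. \<rho> (x k) (N (x k))"
  obtain K where K: "\<And>u v. \<lbrakk>u \<in> X; v \<in> X\<rbrakk> \<Longrightarrow> \<rho> u v \<le> K * (\<rho> u (N u) + \<rho> v (N v))"
    using distance_le_displacements by blast
  have "((\<lambda>q. K * (?e (fst q) + ?e (snd q))) \<longlongrightarrow> K * (0 + 0)) (sequentially \<times>\<^sub>F sequentially)"
    by (intro tendsto_intros filterlim_compose[OF disp filterlim_fst]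
        filterlim_compose[OF disp filterlim_snd])
  then have lim: "((\<lambda>q. K * (?e (fst q) + ?e (snd q))) \<longlongrightarrow> 0) (sequentially \<times>\<^sub>F sequentially)"
    by simp
  show ?thesis
    by (rule tendsto_sandwich[OF _ _ tendsto_const lim])
      (auto intro!: always_eventually nonneg K X)
qed

lemma converges_to_fixed_point:
  assumes l: "l \<in> X" "N l = l" and x: "range x \<subseteq> X"
    and disp: "(\<lambda>k. \<rho> (x k) (N (x k))) \<longlonglongrightarrow> 0"
  shows "(\<lambda>k. \<rho> (x k) l) \<longlonglongrightarrow> 0"
proof -
  have X: "x k \<in> X" for k using x by auto
  obtain K where K: "\<And>u v. \<lbrakk>u \<in> X; v \<in> X\<rbrakk> \<Longrightarrow> \<rho> u v \<le> K * (\<rho> u (N u) + \<rho> v (N v))"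
    using distance_le_displacements by blast
  have le: "\<rho> (x k) l \<le> K * \<rho> (x k) (N (x k))" for k
    using K[OF X l(1), of k] l by (simp add: self_distance)
  show ?thesis
    by (rule tendsto_sandwich[OF _ _ tendsto_const tendsto_mult_right_zero[OF disp, of K]])
      (auto intro!: always_eventually nonneg X l le)
qed

lemma Picard_displacement_tendsto_0:
  assumes u: "u \<in> X"
  shows "(\<lambda>k. \<rho> ((N ^^ k) u) (N ((N ^^ k) u))) \<longlonglongrightarrow> 0"
proof -
  have le: "\<rho> ((N ^^ k) u) (N ((N ^^ k) u)) \<le> c k * \<rho> u (N u)" for k
    using lipschitz[OF u maps[OF u], of k] by (simp add: funpow_swap1)
  show ?thesis
    by (rule tendsto_sandwich[OF _ _ tendsto_const
          tendsto_mult_left_zero[OF c_tendsto_0, of "\<rho> u (N u)"]])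
      (auto intro!: always_eventually nonneg maps iterate_in u le)
qed

text \<open>
  The distance \<open>\<rho>\<close> need not be continuous, so one cannot pass to the limit inside it; the
  relaxed triangle inequality through \<open>(N ^^ Suc k) u\<close> does the work instead.
\<close>

lemma Picard_limit_fixed:
  assumes u: "u \<in> X" and l: "l \<in> X" and lim: "(\<lambda>k. \<rho> ((N ^^ k) u) l) \<longlonglongrightarrow> 0"
  shows "N l = l"
proof -
  let ?x = "\<lambda>k. (N ^^ k) u"
  have X: "?x k \<in> X" for k using u by (rule iterate_in)
  have le: "\<rho> (N l) l \<le> C * (c 1 * \<rho> (?x k) l + \<rho> (?x (Suc k)) l)" for k
  proof -
    have "\<rho> (N l) l \<le> C * (\<rho> (?x (Suc k)) (N l) + \<rho> (?x (Suc k)) l)"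
      using triangle[OF maps[OF l] X[of "Suc k"] l] unfolding sym[OF maps[OF l] X[of "Suc k"]] .
    also have "\<dots> \<le> C * (c 1 * \<rho> (?x k) l + \<rho> (?x (Suc k)) l)"
      using lipschitz[OF X l, of 1 k] by (intro mult_left_mono add_right_mono C_nonneg) simp
    finally show ?thesis .
  qed
  have "(\<lambda>k. C * (c 1 * \<rho> (?x k) l + \<rho> (?x (Suc k)) l)) \<longlonglongrightarrow> C * (c 1 * 0 + 0)"
    by (intro tendsto_intros lim LIMSEQ_Suc[OF lim])
  then have "\<rho> (N l) l \<le> C * (c 1 * 0 + 0)"
    by (rule LIMSEQ_le_const) (use le in blast)
  then show ?thesis
    using nonneg[OF maps[OF l] l] zero_iff[OF maps[OF l] l] by simp
qed

end

section \<open>Norms of nonnegative vectors and of matrices\<close>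

lemma norm_mono_nonneg_cart:
  fixes a b :: "real ^ 'n"
  assumes "0 \<le> a" "a \<le> b"
  shows "norm a \<le> norm b"
proof (rule norm_le_componentwise_cart)
  fix i
  have "0 \<le> a $ i" "a $ i \<le> b $ i" using assms by (auto simp: less_eq_vec_def)
  then show "norm (a $ i) \<le> norm (b $ i)" by simp
qed

lemma positive_mat_mult_mono:
  fixes M :: "real ^ 'n ^ 'm"
  assumes "positive_mat M" "a \<le> b"
  shows "M *v a \<le> M *v b"
  using assms
  by (auto simp: positive_mat_def less_eq_vec_def matrix_vector_mult_def
      intro!: sum_mono mult_left_mono)

lemma norm_mult_vec_le_component_sum:
  fixes M :: "real ^ 'n ^ 'm"
  shows "norm (M *v a) \<le> (\<Sum>i\<in>UNIV. \<Sum>j\<in>UNIV. \<bar>M $ i $ j\<bar>) * norm a"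
proof -
  have "norm (M *v a) \<le> onorm ((*v) M) * norm a"
    by (intro onorm matrix_vector_mul_bounded_linear)
  also have "\<dots> \<le> (\<Sum>i\<in>UNIV. \<Sum>j\<in>UNIV. \<bar>M $ i $ j\<bar>) * norm a"
    by (intro mult_right_mono onorm_le_matrix_component_sum norm_ge_zero)
  finally show ?thesis .
qed

lemma component_sum_tendsto_0:
  fixes M :: "nat \<Rightarrow> real ^ 'n ^ 'm"
  assumes "M \<longlonglongrightarrow> 0"
  shows "(\<lambda>k. \<Sum>i\<in>UNIV. \<Sum>j\<in>UNIV. \<bar>M k $ i $ j\<bar>) \<longlonglongrightarrow> 0"
proof (intro tendsto_null_sum tendsto_rabs_zero)
  fix i j
  show "(\<lambda>k. M k $ i $ j) \<longlonglongrightarrow> 0"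
    using tendsto_vec_nth[OF tendsto_vec_nth[OF assms], of i j] by simp
qed

lemma iterate_dist_le_matpow:
  assumes "N \<in> X \<rightarrow> X" "positive_mat A"
    and lip: "\<forall>x\<in>X. \<forall>y\<in>X. d (N x) (N y) \<le> A *v d x y"
    and u: "u \<in> X" and v: "v \<in> X"
  shows "d ((N ^^ m) u) ((N ^^ m) v) \<le> matpow A m *v d u v"
proof (induction m)
  case 0
  then show ?case by simp
next
  case (Suc m)
  have in_X: "(N ^^ m) w \<in> X" if "w \<in> X" for w
    using that assms(1) by (induction m) auto
  have "d ((N ^^ Suc m) u) ((N ^^ Suc m) v) \<le> A *v d ((N ^^ m) u) ((N ^^ m) v)"
    using lip in_X u v by simp
  also have "\<dots> \<le> A *v (matpow A m *v d u v)"
    by (rule positive_mat_mult_mono[OF assms(2) Suc])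
  finally show ?case by (simp add: matrix_vector_mul_assoc)
qed

section \<open>Stability of Perov contractions\<close>

theorem theorem3p6:
  fixes A B :: "real ^ 'n ^ 'n"
    and X :: "'a set"
    and d :: "'a \<Rightarrow> 'a \<Rightarrow> real ^ 'n"
    and N :: "'a \<Rightarrow> 'a"
  assumes "vector_B_metric B X d"
    and "vcomplete X d"
    and "X \<noteq> {}"
    and "N \<in> X \<rightarrow> X"
    and "positive_mat A"
    and "mat_convergent_to_zero A"
    and "\<forall>x\<in>X. \<forall>y\<in>X. d (N x) (N y) \<le> A *v d x y"
    and "(inverse_positive B \<and> inverse_positive (matrix_inv B - A))
       \<or> (positive_mat B \<and> inverse_positive (mat 1 - B ** A))"
  shows "Reich_Zaslavski_stable X d N"
proof -
  let ?\<rho> = "\<lambda>u v. norm (d u v)" and ?C = "onorm ((*v) B)"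
  let ?c = "\<lambda>k. \<Sum>i\<in>UNIV. \<Sum>j\<in>UNIV. \<bar>matpow A k $ i $ j\<bar>"
  have d_nonneg: "0 \<le> d u v" and d_zero: "d u v = 0 \<longleftrightarrow> u = v" and d_sym: "d u v = d v u"
    if "u \<in> X" "v \<in> X" for u v
    using assms(1) that by (auto simp: vector_B_metric_def)
  interpret b_metric_iterated_contraction X ?\<rho> ?C N ?c
  proof
    fix u v w assume u: "u \<in> X" and v: "v \<in> X" and w: "w \<in> X"
    have "?\<rho> u w \<le> norm (B *v (d u v + d v w))"
      using assms(1) u v w by (intro norm_mono_nonneg_cart) (auto simp: vector_B_metric_def)
    also have "\<dots> \<le> ?C * norm (d u v + d v w)"
      by (intro onorm matrix_vector_mul_bounded_linear)
    also have "\<dots> \<le> ?C * (?\<rho> u v + ?\<rho> v w)"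
      by (intro mult_left_mono norm_triangle_ineq onorm_pos_le matrix_vector_mul_bounded_linear)
    finally show "?\<rho> u w \<le> ?C * (?\<rho> u v + ?\<rho> v w)" .
  next
    fix u v m assume u: "u \<in> X" and v: "v \<in> X"
    have it: "(N ^^ m) w \<in> X" if "w \<in> X" for w
      using that assms(4) by (induction m) auto
    have "norm (d ((N ^^ m) u) ((N ^^ m) v)) \<le> norm (matpow A m *v d u v)"
      by (intro norm_mono_nonneg_cart d_nonneg it u v iterate_dist_le_matpow[OF assms(4,5,7)])
    also have "\<dots> \<le> ?c m * ?\<rho> u v"
      by (rule norm_mult_vec_le_component_sum)
    finally show "norm (d ((N ^^ m) u) ((N ^^ m) v)) \<le> ?c m * ?\<rho> u v" .
  next
    show "?c \<longlonglongrightarrow> 0"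
      using assms(6) by (intro component_sum_tendsto_0) (simp add: mat_convergent_to_zero_def)
  qed (use assms(4) d_zero d_sym in
      \<open>auto intro!: onorm_pos_le matrix_vector_mul_bounded_linear sum_nonneg\<close>)
  obtain u where u: "u \<in> X" using assms(3) by blast
  have range: "range (\<lambda>k. (N ^^ k) u) \<subseteq> X" using iterate_in[OF u] by auto
  have "vCauchy d (\<lambda>k. (N ^^ k) u)"
    using Cauchy_of_vanishing_displacement[OF range Picard_displacement_tendsto_0[OF u]]
    unfolding vCauchy_def by (subst tendsto_norm_zero_iff[symmetric]) (simp add: case_prod_unfold)
  then obtain l where l: "l \<in> X" "vconverges d (\<lambda>k. (N ^^ k) u) l"
    using assms(2) range unfolding vcomplete_def by blast
  have fixed: "N l = l"
    using l(2) by (intro Picard_limit_fixed[OF u l(1)])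
      (simp add: vconverges_def tendsto_norm_zero)
  moreover have "y = l" if "y \<in> X" "N y = y" for y
    using fixed_point_unique that l(1) fixed by blast
  moreover have "vconverges d x l"
    if "range x \<subseteq> X" "(\<lambda>k. d (x k) (N (x k))) \<longlonglongrightarrow> 0" for x
    unfolding vconverges_def
    using converges_to_fixed_point[OF l(1) fixed that(1) tendsto_norm_zero[OF that(2)]]
    by (rule tendsto_norm_zero_cancel)
  ultimately show ?thesis
    using l(1) unfolding Reich_Zaslavski_stable_def by blast
qed

end
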